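(* For the genus-zero free energy $F$ of the topological $CP^1$ model, the genus-zero topological recursion relation $$\langle\sigma_n(\mathcal O_\alpha)XY\rangle=\sum_{\beta}\langle\sigma_{n-1}(\mathcal O_\alpha)\mathcal O^\beta\rangle\,\langle\mathcal O_\beta XY\rangle$$ implies the dispersionless Hirota equations $$\frac{F_{n+1,m}}{n+1}+\frac{F_{n,m+1}}{m+1}=F_{m,0}F_{n,1}+F_{m,1}F_{n,0}\qquad (n\ge 1,\ m\ge 1),$$ $$\frac{F_{\widehat{n+1},m}}{n+1}+\frac{F_{\hat n,m+1}}{m+1}=F_{m,0}F_{\hat n,1}+F_{m,1}F_{\hat n,0}\qquad (m\ge 1,\ n\ge 0),$$ $$\frac{F_{\widehat{n+1},\hat m}}{n+1}+\frac{F_{\hat n,\widehat{m+1}}}{m+1}=F_{\hat m,0}F_{\hat n,1}+F_{\hat m,1}F_{\hat n,0}\qquad (m,n\ge 0).$$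
   Context: Topological $CP^1$ model coupled to topological gravity, at genus zero. The primary fields are $\mathcal O_1=P$ (the puncture operator, corresponding to $1\in H^0(CP^1)$) and $\mathcal O_2=Q$ (corresponding to $\omega\in H^2(CP^1)$), with gravitational descendants $\sigma_n(\mathcal O_\alpha)$, $n\ge0$, $\sigma_0(\mathcal O_\alpha)=\mathcal O_\alpha$, and coupling constants $T^{\alpha,n}$ ($\alpha=1,2$). The genus-zero free energy is the generating function $F=\langle e^{\sum_{\alpha,n}T^{\alpha,n}\sigma_n(\mathcal O_\alpha)}\rangle_0$, and genus-zero correlation functions are $$\langle\sigma_{n_1}(\mathcal O_{\alpha_1})\cdots\sigma_{n_m}(\mathcal O_{\alpha_m})\rangle=\frac{\partial^mF}{\partial T^{\alpha_1,n_1}\cdots\partial T^{\alpha_m,n_m}}.$$ The metric $\eta_{\alpha\beta}=\langle P\mathcal O_\alpha\mathcal O_\beta\rangle$ has $\eta_{11}=\eta_{22}=0$, $\eta_{12}=\eta_{21}=1$, so $\mathcal O^1=\mathcal O_2=Q$ and $\mathcal O^2=\mathcal O_1=P$. In the recursion relation $n\ge1$, $\alpha,\beta\in\{1,2\}$, and $X,Y$ are arbitrary fields among the $\sigma_k(\mathcal O_\gamma)$. Change of variables: $t_{n+1}=\dfrac{T^{2,n}}{(n+1)!}$ and $\hat t_n=\dfrac{2T^{1,n}}{n!}$ for $n\ge0$, with $\hat t_0=2t_0=2T^{1,0}$. Under this identification $F$ is the free energy $F(t_0,t,\hat t)$ of the extended dispersionless Toda hierarchy. Subscripts on $F$ denote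 derivatives: index $0$ is $\partial_{t_0}$, index $n\ge1$ is $\partial_{t_n}$, index $\hat n$ ($n\ge0$) is $\partial_{\hat t_n}$. Hence $\langle\sigma_m(P)\sigma_n(P)\rangle=\frac{4F_{\hat m\hat n}}{m!n!}$ ($m,n\ge0$), $\langle\sigma_m(P)\sigma_{n-1}(Q)\rangle=\frac{2F_{\hat mn}}{m!n!}$ ($m\ge0,n\ge1$), $\langle\sigma_{m-1}(Q)\sigma_{n-1}(Q)\rangle=\frac{F_{mn}}{m!n!}$ ($m,n\ge1$). *)

theory Defs
  imports Complex_Main "HOL-Library.Multiset"
begin

section \<open>Formal power series in a family of variables\<close>

text \<open>
  A monomial in the variables \<open>'v\<close> (possibly infinitely many) is a finite multiset of variables;
  a formal power series assigns to every monomial its plain coefficient (no factorials).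
\<close>

typedef 'v mfps = "UNIV :: ('v multiset \<Rightarrow> real) set"
  morphisms coeff Abs_mfps ..

setup_lifting type_definition_mfps

lemma mfps_eqI: "(\<And>M. coeff f M = coeff g M) \<Longrightarrow> f = g"
  by (transfer) auto

lemma finite_submultisets: "finite {A. A \<subseteq># (M :: 'v multiset)}"
proof (induction M)
  case (add x M)
  have "A \<in> {A. A \<subseteq># M} \<union> add_mset x ` {A. A \<subseteq># M}" if "A \<subseteq># add_mset x M" for A
  proof (cases "x \<in># A")
    case True
    then have "A = add_mset x (A - {#x#})" by simp
    with that show ?thesis by (metis UnI2 image_eqI mem_Collect_eq mset_subset_eq_add_mset_cancel)
  next
    case False
    with that show ?thesis by (metis UnI1 mem_Collect_eq subset_eq_diff_conv diff_single_trivial add_mset_add_single)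
  qed
  then have "{A. A \<subseteq># add_mset x M} \<subseteq> {A. A \<subseteq># M} \<union> add_mset x ` {A. A \<subseteq># M}"
    by blast
  with add show ?case by (meson finite_UnI finite_imageI finite_subset)
qed simp

instantiation mfps :: (type) ab_group_add
begin
lift_definition zero_mfps :: "'a mfps" is "\<lambda>_. 0" .
lift_definition plus_mfps :: "'a mfps \<Rightarrow> 'a mfps \<Rightarrow> 'a mfps" is "\<lambda>f g M. f M + g M" .
lift_definition minus_mfps :: "'a mfps \<Rightarrow> 'a mfps \<Rightarrow> 'a mfps" is "\<lambda>f g M. f M - g M" .
lift_definition uminus_mfps :: "'a mfps \<Rightarrow> 'a mfps" is "\<lambda>f M. - f M" .
instance by standard (transfer; auto simp: fun_eq_iff)+
end

instantiation mfps :: (type) real_vector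
begin
lift_definition scaleR_mfps :: "real \<Rightarrow> 'a mfps \<Rightarrow> 'a mfps" is "\<lambda>c f M. c * f M" .
instance by standard (transfer; auto simp: fun_eq_iff algebra_simps)+
end

instantiation mfps :: (type) comm_ring_1
begin

lift_definition one_mfps :: "'a mfps" is "\<lambda>M. if M = {#} then 1 else 0" .

lift_definition times_mfps :: "'a mfps \<Rightarrow> 'a mfps \<Rightarrow> 'a mfps" is
  "\<lambda>f g M. \<Sum>A | A \<subseteq># M. f A * g (M - A)" .

instance
proof
  fix f g h :: "'a mfps"
  show "f * g * h = f * (g * h)"
  proof (transfer, rule ext)
    fix f g h :: "'a multiset \<Rightarrow> real" and M
    have "(\<Sum>A | A \<subseteq># M. (\<Sum>B | B \<subseteq># A. f B * g (A - B)) * h (M - A))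
        = (\<Sum>(A, B)\<in>(SIGMA A:{A. A \<subseteq># M}. {B. B \<subseteq># A}). f B * g (A - B) * h (M - A))"
      by (simp add: sum.Sigma finite_submultisets sum_distrib_right)
    also have "\<dots> = (\<Sum>(B, C)\<in>(SIGMA B:{B. B \<subseteq># M}. {C. C \<subseteq># M - B}).
        f B * (g C * h (M - B - C)))"
      by (rule sum.reindex_bij_witness[where i = "\<lambda>(B, C). (B + C, B)" and j = "\<lambda>(A, B). (B, A - B)"])
        (clarsimp elim!: subset_mset.less_eqE simp: add.assoc mult.assoc)+
    also have "\<dots> = (\<Sum>B | B \<subseteq># M. f B * (\<Sum>C | C \<subseteq># M - B. g C * h (M - B - C)))"
      by (simp add: sum.Sigma finite_submultisets sum_distrib_left)
    finally show "(\<Sum>A | A \<subseteq># M. (\<Sum>B | B \<subseteq># A. f B * g (A - B)) * h (M - A)) = \<dots>" .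
  qed
  show "f * g = g * f"
  proof (transfer, rule ext)
    fix f g :: "'a multiset \<Rightarrow> real" and M
    show "(\<Sum>A | A \<subseteq># M. f A * g (M - A)) = (\<Sum>A | A \<subseteq># M. g A * f (M - A))"
      by (rule sum.reindex_bij_witness[where i = "\<lambda>A. M - A" and j = "\<lambda>A. M - A"])
        (clarsimp elim!: subset_mset.less_eqE)+
  qed
  show "1 * f = f"
  proof (transfer, rule ext)
    fix f :: "'a multiset \<Rightarrow> real" and M
    have "(\<Sum>A | A \<subseteq># M. (if A = {#} then 1 else 0) * f (M - A))
        = (\<Sum>A | A \<subseteq># M. if A = {#} then f (M - A) else 0)"
      by (rule sum.cong) auto
    then show "(\<Sum>A | A \<subseteq># M. (if A = {#} then 1 else 0) * f (M - A)) = f M"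
      by (simp add: finite_submultisets)
  qed
  show "(f + g) * h = f * h + g * h"
    by transfer (auto simp: fun_eq_iff algebra_simps sum.distrib)
  show "(0 :: 'a mfps) \<noteq> 1"
    by transfer (auto simp: fun_eq_iff)
qed

end

lift_definition pderiv :: "'v \<Rightarrow> 'v mfps \<Rightarrow> 'v mfps" is
  "\<lambda>x f M. real (Suc (count M x)) * f (add_mset x M)" .

text \<open>The substitution \<open>x \<mapsto> c x \<cdot> x\<close> for all variables \<open>x\<close>.\<close>

lift_definition rescale :: "('v \<Rightarrow> real) \<Rightarrow> 'v mfps \<Rightarrow> 'v mfps" is
  "\<lambda>c f M. (\<Prod>x\<in>#M. c x) * f M" .

lemma pderiv_rescale: "pderiv x (rescale c f) = c x *\<^sub>R rescale c (pderiv x f)"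
  by transfer (auto simp: fun_eq_iff)


section \<open>Genus-zero correlators of the topological \<open>CP\<^sup>1\<close> model\<close>

text \<open>\<open>Pt\<close> is the puncture operator \<open>P\<close> (the class \<open>1\<close>) and \<open>Qt\<close> is \<open>Q\<close> (the class \<open>\<omega>\<close>).\<close>

datatype primary = Pt | Qt

fun cdeg :: "primary \<Rightarrow> nat" where
  "cdeg Pt = 0"
| "cdeg Qt = 1"

text \<open>\<open>\<sigma> n \<alpha>\<close> is the \<open>n\<close>-th gravitational descendant of \<open>\<alpha>\<close>.\<close>

datatype observable = Desc (level: nat) (base: primary) (\<open>\<sigma>\<close>)

definition stable :: "nat \<Rightarrow> observable multiset \<Rightarrow> bool" where
  "stable d M \<longleftrightarrow> d > 0 \<or> size M \<ge> 3"

text \<open>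
  \<open>N d M\<close> is the contribution of the maps of degree \<open>d\<close> to the genus-zero correlator of the fields
  in \<open>M\<close> at vanishing couplings (the genus-zero descendant Gromov--Witten invariants of \<open>CP\<^sup>1\<close>).
  The moduli spaces themselves are not available; the invariants are given by the defining
  properties of the theory: the ghost number selection rule
  (the virtual dimension is \<open>2 d - 2 + m\<close>), the classical three-point functions
  \<open>\<integral> \<alpha> \<union> \<beta> \<union> \<gamma>\<close> in degree zero, the single degree-one map
  up to reparametrisation, and the puncture (string), divisor and dilaton equations.
  The topological recursion relation is not among them.
\<close>

locale cp1_genus_zero =
  fixes N :: "nat \<Rightarrow> observable multiset \<Rightarrow> real"
  assumes unstable: "\<not> stable d M \<Longrightarrow> N d M = 0"
    and selection: "N d M \<noteq> 0 \<Longrightarrow>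
      (\<Sum>x\<in>#M. int (level x + cdeg (base x))) = 2 * int d - 2 + int (size M)"
    and three_point: "N 0 {#\<sigma> k \<alpha>, \<sigma> l \<beta>, \<sigma> n \<gamma>#} =
      (if k = 0 \<and> l = 0 \<and> n = 0 \<and> cdeg \<alpha> + cdeg \<beta> + cdeg \<gamma> = 1 then 1 else 0)"
    and degree_one: "N 1 {#} = 1"
    and puncture: "stable d M \<Longrightarrow>
      N d (add_mset (\<sigma> 0 Pt) M) =
        (\<Sum>x\<in>#M. case x of \<sigma> 0 _ \<Rightarrow> 0
                    | \<sigma> (Suc n) \<alpha> \<Rightarrow> N d (add_mset (\<sigma> n \<alpha>) (M - {#x#})))"
    and divisor: "stable d M \<Longrightarrow>
      N d (add_mset (\<sigma> 0 Qt) M) = real d * N d M +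
        (\<Sum>x\<in>#M. case x of \<sigma> (Suc n) Pt \<Rightarrow> N d (add_mset (\<sigma> n Qt) (M - {#x#}))
                    | _ \<Rightarrow> 0)"
    and dilaton: "stable d M \<Longrightarrow>
      N d (add_mset (\<sigma> 1 Pt) M) = (real (size M) - 2) * N d M"

text \<open>
  The correlator at vanishing couplings sums over all degrees; by the selection rule at most one
  degree contributes.
\<close>

definition vacuum_correlator :: "(nat \<Rightarrow> observable multiset \<Rightarrow> real) \<Rightarrow> observable multiset \<Rightarrow> real" where
  "vacuum_correlator N M = (\<Sum>d | N d M \<noteq> 0. N d M)"

text \<open>
  The formal power series \<open>\<langle>exp (\<Sum> T\<^sup>\<alpha>\<^sup>,\<^sup>n \<sigma> n \<alpha>)\<rangle>\<close>, where the observable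
  \<open>\<sigma> n \<alpha>\<close> itself serves as the name of the coupling constant \<open>T\<^sup>\<alpha>\<^sup>,\<^sup>n\<close>.
\<close>

definition free_energy :: "(nat \<Rightarrow> observable multiset \<Rightarrow> real) \<Rightarrow> observable mfps" where
  "free_energy N =
    Abs_mfps (\<lambda>M. vacuum_correlator N M / (\<Prod>x\<in>set_mset M. fact (count M x)))"

definition correlator :: "observable mfps \<Rightarrow> observable list \<Rightarrow> observable mfps" where
  "correlator F xs = foldr pderiv xs F"

text \<open>
  Indices are raised with the metric \<open>\<eta>\<close>, for which \<open>P\<close> and \<open>Q\<close> are dual to each other;
  see the lemma \<open>metric\<close> below.
\<close>

fun dual :: "primary \<Rightarrow> primary" where
  "dual Pt = Qt"
| "dual Qt = Pt"

lemma (in cp1_genus_zero) metric: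
  "vacuum_correlator N {#\<sigma> 0 Pt, \<sigma> 0 \<alpha>, \<sigma> 0 \<beta>#} = (if \<beta> = dual \<alpha> then 1 else 0)"
proof -
  have pos: "N d {#\<sigma> 0 Pt, \<sigma> 0 \<alpha>, \<sigma> 0 \<beta>#} = 0" if "d > 0" for d
    using puncture[of d "{#\<sigma> 0 \<alpha>, \<sigma> 0 \<beta>#}"] that by (simp add: stable_def)
  have zero: "N 0 {#\<sigma> 0 Pt, \<sigma> 0 \<alpha>, \<sigma> 0 \<beta>#} = (if \<beta> = dual \<alpha> then 1 else 0)"
    by (cases \<alpha>; cases \<beta>) (simp_all add: three_point)
  have "{d. N d {#\<sigma> 0 Pt, \<sigma> 0 \<alpha>, \<sigma> 0 \<beta>#} \<noteq> 0} = (if \<beta> = dual \<alpha> then {0} else {})"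
    using pos zero by (auto simp: set_eq_iff) (metis neq0_conv)+
  then show ?thesis
    unfolding vacuum_correlator_def using zero by (cases "\<beta> = dual \<alpha>") simp_all
qed

definition topological_recursion :: "observable mfps \<Rightarrow> bool" where
  "topological_recursion F \<longleftrightarrow>
    (\<forall>n \<alpha> X Y. n \<ge> 1 \<longrightarrow>
      correlator F [\<sigma> n \<alpha>, X, Y] =
        (\<Sum>\<beta>\<in>{Pt, Qt}. correlator F [\<sigma> (n - 1) \<alpha>, \<sigma> 0 (dual \<beta>)] * correlator F [\<sigma> 0 \<beta>, X, Y]))"


section \<open>Toda times\<close>

text \<open>
  The change of variables \<open>T\<^sup>2\<^sup>,\<^sup>n = (n + 1)! t\<^sub>n\<^sub>+\<^sub>1\<close>, \<open>T\<^sup>1\<^sup>,\<^sup>n = (n! / 2) h\<^sub>n\<close>, where \<open>h\<^sub>n\<close> is the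
  hatted time. After rescaling, the variable \<open>\<sigma> n Qt\<close> stands for \<open>t\<^sub>n\<^sub>+\<^sub>1\<close> and \<open>\<sigma> n Pt\<close> for \<open>h\<^sub>n\<close>.
  The superscripts \<open>1\<close> and \<open>2\<close> refer to \<open>Pt\<close> and \<open>Qt\<close>.
\<close>

fun toda_factor :: "observable \<Rightarrow> real" where
  "toda_factor (\<sigma> n Pt) = fact n / 2"
| "toda_factor (\<sigma> n Qt) = fact (Suc n)"

definition toda_free_energy :: "(nat \<Rightarrow> observable multiset \<Rightarrow> real) \<Rightarrow> observable mfps" where
  "toda_free_energy N = rescale toda_factor (free_energy N)"

text \<open>\<open>Time n\<close> is the index \<open>n\<close> and \<open>Hat n\<close> the hatted index \<open>n\<close> of a derivative.\<close>

datatype toda_index = Time nat | Hat nat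

text \<open>The time \<open>t\<^sub>0\<close> is not an independent variable: \<open>h\<^sub>0 = 2 t\<^sub>0\<close>.\<close>

fun toda_deriv :: "toda_index \<Rightarrow> observable mfps \<Rightarrow> observable mfps" where
  "toda_deriv (Time 0) G = 2 *\<^sub>R pderiv (\<sigma> 0 Pt) G"
| "toda_deriv (Time (Suc n)) G = pderiv (\<sigma> n Qt) G"
| "toda_deriv (Hat n) G = pderiv (\<sigma> n Pt) G"

definition toda_deriv2 :: "observable mfps \<Rightarrow> toda_index \<Rightarrow> toda_index \<Rightarrow> observable mfps" where
  "toda_deriv2 G i j = toda_deriv i (toda_deriv j G)"

lemma rescale_scaleR: "rescale c (a *\<^sub>R f) = a *\<^sub>R rescale c f"
  by transfer (auto simp: fun_eq_iff)

lemma pderiv_scaleR: "pderiv x (a *\<^sub>R f) = a *\<^sub>R pderiv x f"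
  by transfer (auto simp: fun_eq_iff)

lemma two_point_functions:
  fixes m n :: nat and N :: "nat \<Rightarrow> observable multiset \<Rightarrow> real"
  defines "G \<equiv> toda_free_energy N" and "F \<equiv> free_energy N"
  shows "rescale toda_factor (correlator F [\<sigma> m Pt, \<sigma> n Pt]) =
      (4 / (fact m * fact n)) *\<^sub>R toda_deriv2 G (Hat m) (Hat n)"
    and "n \<ge> 1 \<Longrightarrow> rescale toda_factor (correlator F [\<sigma> m Pt, \<sigma> (n - 1) Qt]) =
      (2 / (fact m * fact n)) *\<^sub>R toda_deriv2 G (Hat m) (Time n)"
    and "m \<ge> 1 \<Longrightarrow> n \<ge> 1 \<Longrightarrow> rescale toda_factor (correlator F [\<sigma> (m - 1) Qt, \<sigma> (n - 1) Qt]) =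
      (1 / (fact m * fact n)) *\<^sub>R toda_deriv2 G (Time m) (Time n)"
  by (cases m; cases n;
      simp add: assms toda_free_energy_def correlator_def toda_deriv2_def pderiv_rescale
        pderiv_scaleR rescale_scaleR del: fact_Suc)+

end

theory Submission
  imports Defs
begin

text \<open>
  By the Leibniz rule, the recursion relation says that both sides of
  \<open>\<langle>\<sigma>\<^sub>n\<^sub>+\<^sub>1(\<alpha>) \<sigma>\<^sub>m(\<beta>)\<rangle> + \<langle>\<sigma>\<^sub>n(\<alpha>) \<sigma>\<^sub>m\<^sub>+\<^sub>1(\<beta>)\<rangle> = \<Sum>\<^sub>\<gamma> \<langle>\<sigma>\<^sub>n(\<alpha>) \<O>\<^sup>\<gamma>\<rangle> \<langle>\<O>\<^sub>\<gamma> \<sigma>\<^sub>m(\<beta>)\<rangle>\<close>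
  have the same derivative in every coupling constant. At vanishing couplings the puncture equation
  turns the left-hand side into \<open>\<langle>P \<sigma>\<^sub>n\<^sub>+\<^sub>1(\<alpha>) \<sigma>\<^sub>m\<^sub>+\<^sub>1(\<beta>)\<rangle>\<close>; the recursion relation and a second use of
  the puncture equation turn this into the right-hand side. All three Hirota equations are this
  identity in the Toda times.
\<close>

section \<open>Differential calculus of formal power series\<close>

lemma coeff_add: "coeff (f + g) M = coeff f M + coeff g M"
  by transfer simp

lemma coeff_scaleR: "coeff (c *\<^sub>R f) M = c * coeff f M"
  by transfer simp

lemma coeff_mult: "coeff (f * g) M = (\<Sum>A | A \<subseteq># M. coeff f A * coeff g (M - A))"
  by transfer simp

lemma coeff_pderiv: "coeff (pderiv x f) M = real (Suc (count M x)) * coeff f (add_mset x M)"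
  by transfer simp

lemma coeff_rescale: "coeff (rescale c f) M = (\<Prod>x\<in>#M. c x) * coeff f M"
  by transfer simp

text \<open>Compatibility of scalars with products lets the simplifier pull the scaling factors of
  the Toda times out of products of series.\<close>

instance mfps :: (type) real_algebra_1
proof
  fix a :: real and f g :: "'a mfps"
  show "a *\<^sub>R f * g = a *\<^sub>R (f * g)" "f * a *\<^sub>R g = a *\<^sub>R (f * g)"
    by (rule mfps_eqI, simp add: coeff_mult coeff_scaleR sum_distrib_left mult.assoc mult.left_commute)+
qed

lemma pderiv_add: "pderiv x (f + g) = pderiv x f + pderiv x g"
  by (rule mfps_eqI) (simp add: coeff_pderiv coeff_add algebra_simps)

lemma pderiv_commute: "pderiv x (pderiv y f) = pderiv y (pderiv x f)"
  by (rule mfps_eqI) (simp add: coeff_pderiv add_mset_commute)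

text \<open>Submultisets without \<open>x\<close> have weight zero, and the others are exactly
  \<open>add_mset x A\<close> with \<open>A \<subseteq># M\<close>. This is one half of the Leibniz
  rule.\<close>

lemma sum_submultisets_count:
  fixes h :: "'v multiset \<Rightarrow> real"
  shows "(\<Sum>A | A \<subseteq># add_mset x M. real (count A x) * h A) =
    (\<Sum>A | A \<subseteq># M. real (Suc (count A x)) * h (add_mset x A))"
proof -
  have "(\<Sum>A | A \<subseteq># add_mset x M. real (count A x) * h A) =
      (\<Sum>A\<in>add_mset x ` {A. A \<subseteq># M}. real (count A x) * h A)"
  proof (rule sum.mono_neutral_right)
    show "\<forall>A\<in>{A. A \<subseteq># add_mset x M} - add_mset x ` {A. A \<subseteq># M}. real (count A x) * h A = 0"
    proof
      fix A assume A: "A \<in> {A. A \<subseteq># add_mset x M} - add_mset x ` {A. A \<subseteq># M}"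
      have "x \<notin># A"
      proof
        assume "x \<in># A"
        then obtain B where "A = add_mset x B" by (meson mset_add)
        with A show False by auto
      qed
      then show "real (count A x) * h A = 0" by (simp add: not_in_iff)
    qed
  qed (auto simp: finite_submultisets)
  then show ?thesis by (simp add: sum.reindex inj_on_def)
qed

lemma pderiv_mult: "pderiv x (f * g) = pderiv x f * g + f * pderiv x g"
proof (rule mfps_eqI)
  fix M
  have "coeff (pderiv x (f * g)) M = (\<Sum>A | A \<subseteq># add_mset x M.
      real (count (add_mset x M) x) * (coeff f A * coeff g (add_mset x M - A)))"
    by (simp add: coeff_pderiv coeff_mult sum_distrib_left)
  \<comment> \<open>The multiplicity of \<open>x\<close> is shared between \<open>A\<close> and its
    complement; the two shares give the two terms of the Leibniz rule.\<close>
  also have "\<dots> = (\<Sum>A | A \<subseteq># add_mset x M.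
        real (count A x) * (coeff f A * coeff g (add_mset x M - A))) +
      (\<Sum>A | A \<subseteq># add_mset x M.
        real (count (add_mset x M - A) x) * (coeff f A * coeff g (add_mset x M - A)))"
    unfolding sum.distrib[symmetric]
  proof (rule sum.cong)
    fix A assume "A \<in> {A. A \<subseteq># add_mset x M}"
    then have "real (count (add_mset x M) x) = real (count A x) + real (count (add_mset x M - A) x)"
      by (metis count_union mem_Collect_eq of_nat_add subset_mset.add_diff_inverse)
    then show "real (count (add_mset x M) x) * (coeff f A * coeff g (add_mset x M - A)) =
        real (count A x) * (coeff f A * coeff g (add_mset x M - A)) +
        real (count (add_mset x M - A) x) * (coeff f A * coeff g (add_mset x M - A))"
      by (simp only: distrib_right)
  qed simp
  \<comment> \<open>Passing to complements moves the weight onto \<open>A\<close>, so that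
    \<open>sum_submultisets_count\<close> covers this share as well.\<close>
  also have "(\<Sum>A | A \<subseteq># add_mset x M.
        real (count (add_mset x M - A) x) * (coeff f A * coeff g (add_mset x M - A))) =
      (\<Sum>A | A \<subseteq># add_mset x M. real (count A x) * (coeff f (add_mset x M - A) * coeff g A))"
    by (rule sum.reindex_bij_witness[where i = "\<lambda>A. add_mset x M - A" and j = "\<lambda>A. add_mset x M - A"])
      (auto simp: subset_mset.diff_diff_right)
  also have "(\<Sum>A | A \<subseteq># add_mset x M.
        real (count A x) * (coeff f A * coeff g (add_mset x M - A))) = coeff (pderiv x f * g) M"
    by (simp add: sum_submultisets_count coeff_mult coeff_pderiv mult.assoc)
  also have "(\<Sum>A | A \<subseteq># add_mset x M.
        real (count A x) * (coeff f (add_mset x M - A) * coeff g A)) = coeff (pderiv x g * f) M"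
    by (simp only: sum_submultisets_count coeff_mult coeff_pderiv) (simp add: mult_ac)
  finally show "coeff (pderiv x (f * g)) M = coeff (pderiv x f * g + f * pderiv x g) M"
    by (simp add: coeff_add mult.commute)
qed

text \<open>A nonempty monomial contains some \<open>x\<close>, and its coefficient is recovered
  from the derivative in \<open>x\<close> because \<open>Suc (count M' x)\<close> is
  nonzero.\<close>

lemma mfps_eqI_pderiv:
  assumes "coeff f {#} = coeff g {#}" and "\<And>x. pderiv x f = pderiv x g"
  shows "f = g"
proof (rule mfps_eqI)
  fix M
  show "coeff f M = coeff g M"
  proof (cases M)
    case (add x M')
    have "coeff (pderiv x f) M' = coeff (pderiv x g) M'"
      by (simp add: assms(2))
    then show ?thesis by (simp add: coeff_pderiv add del: of_nat_Suc)
  qed (simp add: assms(1))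
qed

lemma rescale_add: "rescale c (f + g) = rescale c f + rescale c g"
  by (rule mfps_eqI) (simp add: coeff_rescale coeff_add algebra_simps)

lemma rescale_mult: "rescale c (f * g) = rescale c f * rescale c g"
proof (rule mfps_eqI)
  fix M
  have "(\<Prod>x\<in>#M. c x) = (\<Prod>x\<in>#A. c x) * (\<Prod>x\<in>#M - A. c x)" if "A \<subseteq># M" for A
    by (metis image_mset_union prod_mset.union subset_mset.add_diff_inverse that)
  then show "coeff (rescale c (f * g)) M = coeff (rescale c f * rescale c g) M"
    by (simp add: coeff_rescale coeff_mult sum_distrib_left mult_ac)
qed

section \<open>Correlators at vanishing couplings and the two-point recursion\<close>

lemma coeff_correlator_free_energy:
  "coeff (correlator (free_energy N) xs) M =
    vacuum_correlator N (mset xs + M) / (\<Prod>x\<in>set_mset M. fact (count M x))"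
proof (induction xs arbitrary: M)
  case Nil
  show ?case by (simp add: correlator_def free_energy_def Abs_mfps_inverse)
next
  case (Cons x xs)
  \<comment> \<open>Adding \<open>x\<close> multiplies the product of factorials by
    \<open>Suc (count M x)\<close>, which cancels the factor produced by
    \<open>pderiv\<close>.\<close>
  have "(\<Prod>y\<in>set_mset (add_mset x M). fact (count (add_mset x M) y) :: real) =
      (\<Prod>y\<in>set_mset (add_mset x M). (if y = x then real (Suc (count M x)) else 1) * fact (count M y))"
    by (rule prod.cong) auto
  also have "\<dots> = real (Suc (count M x)) * (\<Prod>y\<in>set_mset (add_mset x M). fact (count M y))"
    using union_single_eq_member[of x M]
    by (simp add: prod.distrib del: of_nat_Suc set_mset_add_mset_insert)
  \<comment> \<open>If \<open>x\<close> is absent from \<open>M\<close>, its factor is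
    \<open>fact 0 = 1\<close>.\<close>
  also have "(\<Prod>y\<in>set_mset (add_mset x M). fact (count M y) :: real) =
      (\<Prod>y\<in>set_mset M. fact (count M y))"
    by (rule prod.mono_neutral_right) (auto simp: not_in_iff)
  finally show ?case
    using Cons.IH[of "add_mset x M"]
    by (simp add: correlator_def coeff_pderiv del: of_nat_Suc set_mset_add_mset_insert)
qed

lemma vacuum_correlator_eq:
  assumes "finite D" and "\<And>d. N d M \<noteq> 0 \<Longrightarrow> d \<in> D"
  shows "vacuum_correlator N M = (\<Sum>d\<in>D. N d M)"
  unfolding vacuum_correlator_def
  by (rule sum.mono_neutral_left) (use assms in auto)

context cp1_genus_zero
begin

text \<open>The selection rule fixes \<open>2 * d\<close> in terms of \<open>M\<close>, so at most
  one degree contributes.\<close>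

lemma finite_degrees: "finite {d. N d M \<noteq> 0}"
proof (rule finite_subset)
  show "{d. N d M \<noteq> 0} \<subseteq>
      {nat (((\<Sum>x\<in>#M. int (level x + cdeg (base x))) - int (size M) + 2) div 2)}"
    using selection[of _ M] by auto
qed simp

text \<open>In degree zero two fields are unstable and the puncture equation does not apply. There
  both sides vanish: the left by \<open>three_point\<close>, since descendants of positive level
  occur, the right by \<open>unstable\<close>.\<close>

lemma puncture_two_point:
  "N d {#\<sigma> 0 Pt, \<sigma> (Suc n) \<alpha>, \<sigma> (Suc m) \<beta>#} =
    N d {#\<sigma> n \<alpha>, \<sigma> (Suc m) \<beta>#} + N d {#\<sigma> (Suc n) \<alpha>, \<sigma> m \<beta>#}"
proof (cases "d = 0")
  case True
  then show ?thesis by (simp add: three_point unstable stable_def)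
next
  case False
  then show ?thesis
    using puncture[of d "{#\<sigma> (Suc n) \<alpha>, \<sigma> (Suc m) \<beta>#}"]
    by (simp add: stable_def add_mset_commute)
qed

lemma puncture_primary:
  "N d {#\<sigma> 0 \<gamma>, \<sigma> 0 Pt, \<sigma> (Suc m) \<beta>#} = N d {#\<sigma> 0 \<gamma>, \<sigma> m \<beta>#}"
proof (cases "d = 0")
  case True
  then show ?thesis by (simp add: three_point unstable stable_def)
next
  case False
  then show ?thesis
    using puncture[of d "{#\<sigma> 0 \<gamma>, \<sigma> (Suc m) \<beta>#}"]
    by (simp add: stable_def add_mset_commute)
qed

lemma vacuum_puncture_two_point:
  "vacuum_correlator N {#\<sigma> (Suc n) \<alpha>, \<sigma> 0 Pt, \<sigma> (Suc m) \<beta>#} =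
    vacuum_correlator N {#\<sigma> n \<alpha>, \<sigma> (Suc m) \<beta>#} + vacuum_correlator N {#\<sigma> (Suc n) \<alpha>, \<sigma> m \<beta>#}"
proof -
  \<comment> \<open>The correlators may live in different degrees; a common finite set of degrees
    allows them to be added degree by degree.\<close>
  let ?D = "{d. N d {#\<sigma> n \<alpha>, \<sigma> (Suc m) \<beta>#} \<noteq> 0} \<union> {d. N d {#\<sigma> (Suc n) \<alpha>, \<sigma> m \<beta>#} \<noteq> 0}"
  have D: "finite ?D" by (simp add: finite_degrees)
  have "N d {#\<sigma> (Suc n) \<alpha>, \<sigma> 0 Pt, \<sigma> (Suc m) \<beta>#} =
      N d {#\<sigma> n \<alpha>, \<sigma> (Suc m) \<beta>#} + N d {#\<sigma> (Suc n) \<alpha>, \<sigma> m \<beta>#}" for d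
    using puncture_two_point[of d n \<alpha> m \<beta>] by (simp add: add_mset_commute)
  then show ?thesis
    by (subst (1 2 3) vacuum_correlator_eq[OF D]) (auto simp: sum.distrib)
qed

lemma vacuum_puncture_primary:
  "vacuum_correlator N {#\<sigma> 0 \<gamma>, \<sigma> 0 Pt, \<sigma> (Suc m) \<beta>#} = vacuum_correlator N {#\<sigma> 0 \<gamma>, \<sigma> m \<beta>#}"
  by (simp add: vacuum_correlator_def puncture_primary)

lemma two_point_recursion:
  assumes trr: "topological_recursion (free_energy N)"
  defines "C \<equiv> correlator (free_energy N)"
  shows "C [\<sigma> (Suc n) \<alpha>, \<sigma> m \<beta>] + C [\<sigma> n \<alpha>, \<sigma> (Suc m) \<beta>] =
    C [\<sigma> n \<alpha>, \<sigma> 0 Qt] * C [\<sigma> m \<beta>, \<sigma> 0 Pt] + C [\<sigma> n \<alpha>, \<sigma> 0 Pt] * C [\<sigma> m \<beta>, \<sigma> 0 Qt]"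
    (is "?L = ?R")
proof (rule mfps_eqI_pderiv)
  have rec: "C [\<sigma> (Suc k) \<gamma>, X, Y] =
      C [\<sigma> k \<gamma>, \<sigma> 0 Qt] * C [\<sigma> 0 Pt, X, Y] + C [\<sigma> k \<gamma>, \<sigma> 0 Pt] * C [\<sigma> 0 Qt, X, Y]" for k \<gamma> X Y
    using trr unfolding topological_recursion_def C_def by (auto dest: spec[of _ "Suc k"])
  show "coeff ?L {#} = coeff ?R {#}"
  proof -
    have mult0: "coeff (f * g) {#} = coeff f {#} * coeff g {#}" for f g :: "observable mfps"
      by (simp add: coeff_mult)
    have C0: "coeff (C xs) {#} = vacuum_correlator N (mset xs)" for xs
      by (simp add: C_def coeff_correlator_free_energy)
    have "coeff ?L {#} = coeff (C [\<sigma> (Suc n) \<alpha>, \<sigma> 0 Pt, \<sigma> (Suc m) \<beta>]) {#}"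
      by (simp add: coeff_add C0 vacuum_puncture_two_point)
    also have "\<dots> = coeff ?R {#}"
      using vacuum_puncture_primary[of Pt m \<beta>] vacuum_puncture_primary[of Qt m \<beta>]
      by (simp add: rec coeff_add mult0 C0 add_mset_commute)
    finally show ?thesis .
  qed
  have C2: "pderiv x (C [y, z]) = C [y, z, x]" for x y z
    by (simp add: C_def correlator_def pderiv_commute[of x])
  have swap: "C [y, z, x] = C [z, y, x]" for x y z
    by (simp add: C_def correlator_def pderiv_commute[of y])
  fix x
  \<comment> \<open>After the Leibniz rule, \<open>swap\<close> brings the raised descendant (left)
    or the primary field (right) to the front; \<open>rec\<close> then turns the two terms on the
    left into the four on the right.\<close>
  show "pderiv x ?L = pderiv x ?R"
    by (simp add: pderiv_add pderiv_mult C2 rec swap[of "\<sigma> n \<alpha>"] swap[of "\<sigma> m \<beta>"]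
        algebra_simps)
qed

end

section \<open>Passage to the Toda times\<close>

fun toda_index_of :: "observable \<Rightarrow> toda_index" where
  "toda_index_of (\<sigma> n Pt) = Hat n"
| "toda_index_of (\<sigma> n Qt) = Time (Suc n)"

lemma toda_deriv_index_of: "toda_deriv (toda_index_of x) G = pderiv x G"
  by (cases x rule: toda_index_of.cases) simp_all

lemma toda_factor_nonzero: "toda_factor x \<noteq> 0"
  by (cases x rule: toda_index_of.cases) simp_all

lemma toda_deriv2_index_of:
  "toda_deriv2 (toda_free_energy N) (toda_index_of x) (toda_index_of y) =
    (toda_factor x * toda_factor y) *\<^sub>R rescale toda_factor (correlator (free_energy N) [x, y])"
  by (simp add: toda_deriv2_def toda_deriv_index_of toda_free_energy_def pderiv_rescale
      pderiv_scaleR correlator_def mult.commute)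

text \<open>\<open>Time 0\<close> is not a value of \<open>toda_index_of\<close>; derivatives in it
  are reduced to those in the hatted time of index 0.\<close>

lemma toda_deriv2_Time_0:
  "toda_deriv2 G i (Time 0) = 2 *\<^sub>R toda_deriv2 G i (toda_index_of (\<sigma> 0 Pt))"
  by (cases "(i, G)" rule: toda_deriv.cases)
    (simp_all add: toda_deriv2_def pderiv_scaleR)

text \<open>Writing the denominators as ratios of scaling factors treats all choices of
  \<open>\<alpha>\<close> and \<open>\<beta>\<close> at once.\<close>

lemma (in cp1_genus_zero) hirota:
  assumes "topological_recursion (free_energy N)"
  defines "F \<equiv> \<lambda>x y. toda_deriv2 (toda_free_energy N) (toda_index_of x) y"
  shows "F (\<sigma> (Suc n) \<alpha>) (toda_index_of (\<sigma> m \<beta>)) /\<^sub>R (toda_factor (\<sigma> (Suc n) \<alpha>) / toda_factor (\<sigma> n \<alpha>)) +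
      F (\<sigma> n \<alpha>) (toda_index_of (\<sigma> (Suc m) \<beta>)) /\<^sub>R (toda_factor (\<sigma> (Suc m) \<beta>) / toda_factor (\<sigma> m \<beta>)) =
    F (\<sigma> m \<beta>) (Time 0) * F (\<sigma> n \<alpha>) (Time 1) + F (\<sigma> m \<beta>) (Time 1) * F (\<sigma> n \<alpha>) (Time 0)"
    (is "?L = ?R")
proof -
  define R where "R = (\<lambda>x y. rescale toda_factor (correlator (free_energy N) [x, y]))"
  \<comment> \<open>In \<open>F0\<close> the 2 from \<open>Time 0\<close> cancels
    \<open>toda_factor (\<sigma> 0 Pt) = 1/2\<close>; in \<open>F1\<close> the factor of
    \<open>\<sigma> 0 Qt\<close> is 1.\<close>
  have F: "F x (toda_index_of y) = (toda_factor x * toda_factor y) *\<^sub>R R x y"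
    and F0: "F x (Time 0) = toda_factor x *\<^sub>R R x (\<sigma> 0 Pt)" for x y
    by (simp_all add: F_def R_def toda_deriv2_index_of toda_deriv2_Time_0
        del: toda_index_of.simps)
  have F1: "F x (Time 1) = toda_factor x *\<^sub>R R x (\<sigma> 0 Qt)" for x
    using F[of x "\<sigma> 0 Qt"] by simp
  \<comment> \<open>Each division lowers the level in one scaling factor, leaving both summands with
    the same scalar.\<close>
  have "?L = (toda_factor (\<sigma> n \<alpha>) * toda_factor (\<sigma> m \<beta>)) *\<^sub>R
      (R (\<sigma> (Suc n) \<alpha>) (\<sigma> m \<beta>) + R (\<sigma> n \<alpha>) (\<sigma> (Suc m) \<beta>))"
    unfolding F
    using toda_factor_nonzero[of "\<sigma> (Suc n) \<alpha>"] toda_factor_nonzero[of "\<sigma> (Suc m) \<beta>"]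
    by (simp add: scaleR_add_right field_simps del: toda_factor.simps)
  also have "R (\<sigma> (Suc n) \<alpha>) (\<sigma> m \<beta>) + R (\<sigma> n \<alpha>) (\<sigma> (Suc m) \<beta>) =
      R (\<sigma> n \<alpha>) (\<sigma> 0 Qt) * R (\<sigma> m \<beta>) (\<sigma> 0 Pt) + R (\<sigma> n \<alpha>) (\<sigma> 0 Pt) * R (\<sigma> m \<beta>) (\<sigma> 0 Qt)"
    unfolding R_def rescale_add[symmetric] rescale_mult[symmetric]
    using two_point_recursion[OF assms(1)] by simp
  also have "(toda_factor (\<sigma> n \<alpha>) * toda_factor (\<sigma> m \<beta>)) *\<^sub>R \<dots> = ?R"
    unfolding F0 F1 by (simp add: scaleR_add_right mult_ac del: toda_factor.simps)
  finally show ?thesis .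
qed

lemma toda_factor_ratio:
  "toda_factor (\<sigma> (Suc n) Pt) / toda_factor (\<sigma> n Pt) = real (n + 1)"
  "toda_factor (\<sigma> (Suc n) Qt) / toda_factor (\<sigma> n Qt) = real (Suc n + 1)"
  by (simp_all add: divide_simps)

theorem proposition12:
  fixes N :: "nat \<Rightarrow> observable multiset \<Rightarrow> real"
    and F :: "toda_index \<Rightarrow> toda_index \<Rightarrow> observable mfps"
  assumes cp1: "cp1_genus_zero N"
    and F_def: "F = toda_deriv2 (toda_free_energy N)"
    and trr: "topological_recursion (free_energy N)"
  shows
    "(\<forall>n m. n \<ge> 1 \<longrightarrow> m \<ge> 1 \<longrightarrow>
        F (Time (n + 1)) (Time m) /\<^sub>R real (n + 1) + F (Time n) (Time (m + 1)) /\<^sub>R real (m + 1) =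
        F (Time m) (Time 0) * F (Time n) (Time 1) + F (Time m) (Time 1) * F (Time n) (Time 0)) \<and>
     (\<forall>n m. m \<ge> 1 \<longrightarrow>
        F (Hat (n + 1)) (Time m) /\<^sub>R real (n + 1) + F (Hat n) (Time (m + 1)) /\<^sub>R real (m + 1) =
        F (Time m) (Time 0) * F (Hat n) (Time 1) + F (Time m) (Time 1) * F (Hat n) (Time 0)) \<and>
     (\<forall>n m.
        F (Hat (n + 1)) (Hat m) /\<^sub>R real (n + 1) + F (Hat n) (Hat (m + 1)) /\<^sub>R real (m + 1) =
        F (Hat m) (Time 0) * F (Hat n) (Time 1) + F (Hat m) (Time 1) * F (Hat n) (Time 0))"
proof -
  interpret cp1_genus_zero N by (rule cp1)
  note h = hirota[OF trr, folded F_def, unfolded toda_index_of.simps]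
  show ?thesis
  proof (intro conjI allI impI)
    fix n m :: nat
    assume "n \<ge> 1" "m \<ge> 1"
    \<comment> \<open>\<open>Time n\<close> belongs to \<open>\<sigma> (n - 1) Qt\<close>, so levels
      are one less than Toda indices and the ratio for level \<open>k\<close> is
      \<open>n + 1\<close>.\<close>
    then obtain k l where "n = Suc k" "m = Suc l"
      by (metis One_nat_def Suc_le_D)
    with h[of k Qt l Qt]
    show "F (Time (n + 1)) (Time m) /\<^sub>R real (n + 1) + F (Time n) (Time (m + 1)) /\<^sub>R real (m + 1) =
        F (Time m) (Time 0) * F (Time n) (Time 1) + F (Time m) (Time 1) * F (Time n) (Time 0)"
      unfolding toda_factor_ratio by simp
  next
    fix n m :: nat
    assume "m \<ge> 1"
    then obtain l where "m = Suc l"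
      by (metis One_nat_def Suc_le_D)
    with h[of n Pt l Qt]
    show "F (Hat (n + 1)) (Time m) /\<^sub>R real (n + 1) + F (Hat n) (Time (m + 1)) /\<^sub>R real (m + 1) =
        F (Time m) (Time 0) * F (Hat n) (Time 1) + F (Time m) (Time 1) * F (Hat n) (Time 0)"
      unfolding toda_factor_ratio by simp
  next
    fix n m :: nat
    from h[of n Pt m Pt]
    show "F (Hat (n + 1)) (Hat m) /\<^sub>R real (n + 1) + F (Hat n) (Hat (m + 1)) /\<^sub>R real (m + 1) =
        F (Hat m) (Time 0) * F (Hat n) (Time 1) + F (Hat m) (Time 1) * F (Hat n) (Time 0)"
      unfolding toda_factor_ratio by simp
  qed
qed

end
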